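(* Let $n\ge 0$ be an integer, let $\alpha>0$ be real, let $\lambda\in(0,1)$, and let $i=\sqrt{-1}$. Let $X_{1,\lambda}(\alpha),\dots,X_{n,\lambda}(\alpha)$ be independent Bernoulli random variables with $P\{X_{j,\lambda}(\alpha)=1\}=\frac{\alpha}{\alpha+\lambda j}$ and $P\{X_{j,\lambda}(\alpha)=0\}=1-\frac{\alpha}{\alpha+\lambda j}$ for $j=1,\dots,n$, and put $Z_{n,\lambda}(\alpha)=X_{1,\lambda}(\alpha)+\cdots+X_{n,\lambda}(\alpha)$. Then for every integer $l$ with $0\le l\le n$, $$\frac{1}{2\pi}\int_{-\pi}^{\pi}E\Big[e^{i\theta(Z_{n,\lambda}(\alpha)-l)}\Big]\,d\theta=(-1)^{n-l}\frac{\alpha^{l+1}}{\lambda^{n+1}}\,\frac{\Gamma(\frac{\alpha}{\lambda})}{\Gamma(n+\frac{\alpha}{\lambda}+1)}\sum_{m=l}^{n}S_{2,\lambda}(n+1,m+1)\,S_1(m+1,l+1).$$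
   Context: $\Gamma$ is the Gamma function and $E$ denotes expectation. For real $x$, $(x)_0=1$ and $(x)_n=x(x-1)\cdots(x-n+1)$ for $n\ge1$; the (signed) Stirling numbers of the first kind $S_1(n,l)$ are defined by $(x)_n=\sum_{l=0}^n S_1(n,l)x^l$. The degenerate falling factorial is $(x)_{0,\lambda}=1$, $(x)_{n,\lambda}=x(x-\lambda)(x-2\lambda)\cdots(x-(n-1)\lambda)$ for $n\ge1$, and the degenerate Stirling numbers of the second kind $S_{2,\lambda}(n,l)$ are defined by $(x)_{n,\lambda}=\sum_{l=0}^n S_{2,\lambda}(n,l)(x)_l$. *)

theory Defs
  imports "HOL-Probability.Probability" "HOL-Combinatorics.Stirling"
begin

definition falling_factorial :: "real \<Rightarrow> nat \<Rightarrow> real" where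
  "falling_factorial x n = (\<Prod>k<n. x - real k)"

definition degenerate_falling_factorial :: "real \<Rightarrow> real \<Rightarrow> nat \<Rightarrow> real" where
  "degenerate_falling_factorial lam x n = (\<Prod>k<n. x - real k * lam)"

text \<open>Both kinds of Stirling numbers are defined as the connection coefficients in the
  expansion that introduces them, extended by zero beyond the range of summation. The lemmas
  below show that these coefficients exist and are unique.\<close>

definition S1 :: "nat \<Rightarrow> nat \<Rightarrow> real" where
  "S1 n = (THE c. (\<forall>x. falling_factorial x n = (\<Sum>l\<le>n. c l * x ^ l)) \<and> (\<forall>l>n. c l = 0))"

definition S2_degenerate :: "real \<Rightarrow> nat \<Rightarrow> nat \<Rightarrow> real" where
  "S2_degenerate lam n = (THE c.
     (\<forall>x. degenerate_falling_factorial lam x n = (\<Sum>l\<le>n. c l * falling_factorial x l)) \<and>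
     (\<forall>l>n. c l = 0))"

lemma falling_factorial_Suc:
  "falling_factorial x (Suc n) = falling_factorial x n * (x - real n)"
  by (simp add: falling_factorial_def)

lemma degenerate_falling_factorial_Suc:
  "degenerate_falling_factorial lam x (Suc n) =
     degenerate_falling_factorial lam x n * (x - real n * lam)"
  by (simp add: degenerate_falling_factorial_def)

lemma falling_factorial_expansion:
  "falling_factorial x n = (\<Sum>l\<le>n. (-1) ^ (n + l) * real (stirling n l) * x ^ l)"
proof -
  have "falling_factorial x n = (-1) ^ n * pochhammer (- x) n"
  proof (induction n)
    case 0
    show ?case by (simp add: falling_factorial_def)
  next
    case (Suc n)
    then show ?case
      by (simp add: falling_factorial_Suc pochhammer_Suc algebra_simps)
  qed
  also have "pochhammer (- x) n = (\<Sum>l\<le>n. real (stirling n l) * (- x) ^ l)"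
    by (simp add: stirling_pochhammer)
  also have "(-1) ^ n * \<dots> = (\<Sum>l\<le>n. (-1) ^ (n + l) * real (stirling n l) * x ^ l)"
    unfolding sum_distrib_left
  proof (rule sum.cong)
    fix l
    have "(- x) ^ l = (-1) ^ l * x ^ l" by (rule power_minus)
    then show "(-1) ^ n * (real (stirling n l) * (- x) ^ l) =
        (-1) ^ (n + l) * real (stirling n l) * x ^ l"
      by (simp only: power_add mult_ac)
  qed simp
  finally show ?thesis .
qed

lemma S1_ex1:
  "\<exists>!c. (\<forall>x. falling_factorial x n = (\<Sum>l\<le>n. c l * x ^ l)) \<and> (\<forall>l>n. c l = 0)"
proof (rule ex1I)
  show "(\<forall>x. falling_factorial x n =
            (\<Sum>l\<le>n. ((-1) ^ (n + l) * real (stirling n l)) * x ^ l)) \<and>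
        (\<forall>l>n. (-1) ^ (n + l) * real (stirling n l) = 0)"
    by (simp add: falling_factorial_expansion)
next
  fix c :: "nat \<Rightarrow> real"
  assume c: "(\<forall>x. falling_factorial x n = (\<Sum>l\<le>n. c l * x ^ l)) \<and> (\<forall>l>n. c l = 0)"
  then have "\<forall>x. (\<Sum>l\<le>n. c l * x ^ l) =
      (\<Sum>l\<le>n. ((-1) ^ (n + l) * real (stirling n l)) * x ^ l)"
    by (metis falling_factorial_expansion)
  then have "\<forall>l\<le>n. c l = (-1) ^ (n + l) * real (stirling n l)"
    by (subst (asm) polyfun_eq_coeffs)
  with c show "c = (\<lambda>l. (-1) ^ (n + l) * real (stirling n l))"
    by (metis (no_types, lifting) ext linorder_not_le mult_zero_right of_nat_0 stirling_less)
qed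

lemma S1_expansion: "falling_factorial x n = (\<Sum>l\<le>n. S1 n l * x ^ l)"
  using theI'[OF S1_ex1[of n]] unfolding S1_def[symmetric] by blast

lemma S1_eq_stirling: "S1 n l = (-1) ^ (n + l) * real (stirling n l)"
proof -
  have "S1 n = (\<lambda>l. (-1) ^ (n + l) * real (stirling n l))"
    unfolding S1_def
    by (rule the1_equality[OF S1_ex1]) (simp add: falling_factorial_expansion)
  then show ?thesis by simp
qed

lemma falling_factorial_of_nat_eq_0: "k < l \<Longrightarrow> falling_factorial (real k) l = 0"
  by (auto simp: falling_factorial_def)

lemma falling_factorial_of_nat_self: "falling_factorial (real k) k \<noteq> 0"
  by (auto simp: falling_factorial_def)

lemma S2_degenerate_ex:
  "\<exists>c. (\<forall>x. degenerate_falling_factorial lam x n = (\<Sum>l\<le>n. c l * falling_factorial x l)) \<and>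
       (\<forall>l>n. c l = 0)"
proof (induction n)
  case 0
  show ?case
    by (rule exI[of _ "\<lambda>l. if l = 0 then 1 else 0"])
       (simp add: falling_factorial_def degenerate_falling_factorial_def)
next
  case (Suc n)
  then obtain c where
    c: "\<And>x. degenerate_falling_factorial lam x n = (\<Sum>l\<le>n. c l * falling_factorial x l)"
    and c0: "\<And>l. l > n \<Longrightarrow> c l = 0" by blast
  define d where
    "d l = (if l = 0 then 0 else c (l - 1)) + c l * (real l - real n * lam)" for l
  have "degenerate_falling_factorial lam x (Suc n) =
      (\<Sum>l\<le>Suc n. d l * falling_factorial x l)" for x
  proof -
    have "degenerate_falling_factorial lam x (Suc n) =
        (\<Sum>l\<le>n. c l * falling_factorial x l * (x - real n * lam))"
      by (simp add: degenerate_falling_factorial_Suc c sum_distrib_right)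
    also have "\<dots> = (\<Sum>l\<le>n. c l * falling_factorial x (Suc l) +
        c l * (real l - real n * lam) * falling_factorial x l)"
      by (rule sum.cong) (simp_all add: falling_factorial_Suc algebra_simps)
    also have "\<dots> = (\<Sum>l\<le>n. c l * falling_factorial x (Suc l)) +
        (\<Sum>l\<le>Suc n. c l * (real l - real n * lam) * falling_factorial x l)"
      by (simp add: sum.distrib c0)
    also have "(\<Sum>l\<le>n. c l * falling_factorial x (Suc l)) =
        (\<Sum>l\<le>Suc n. (if l = 0 then 0 else c (l - 1)) * falling_factorial x l)"
      by (subst sum.atMost_Suc_shift) simp
    finally show ?thesis
      by (simp only: d_def distrib_right sum.distrib)
  qed
  moreover have "\<forall>l>Suc n. d l = 0"
    by (simp add: d_def c0)
  ultimately show ?case by blast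
qed

lemma S2_degenerate_ex1:
  "\<exists>!c. (\<forall>x. degenerate_falling_factorial lam x n = (\<Sum>l\<le>n. c l * falling_factorial x l)) \<and>
       (\<forall>l>n. c l = 0)"
proof (rule ex_ex1I[OF S2_degenerate_ex])
  fix c d :: "nat \<Rightarrow> real"
  assume c: "(\<forall>x. degenerate_falling_factorial lam x n =
      (\<Sum>l\<le>n. c l * falling_factorial x l)) \<and> (\<forall>l>n. c l = 0)"
    and d: "(\<forall>x. degenerate_falling_factorial lam x n =
      (\<Sum>l\<le>n. d l * falling_factorial x l)) \<and> (\<forall>l>n. d l = 0)"
  have eq: "(\<Sum>l\<le>n. (c l - d l) * falling_factorial x l) = 0" for x
  proof -
    have "(\<Sum>l\<le>n. c l * falling_factorial x l) = (\<Sum>l\<le>n. d l * falling_factorial x l)"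
      using c d by metis
    then show ?thesis by (simp add: left_diff_distrib sum_subtractf)
  qed
  have "c k = d k" for k
  proof (induction k rule: less_induct)
    case (less k)
    show ?case
    proof (cases "k \<le> n")
      case True
      have "(c l - d l) * falling_factorial (real k) l = 0" if "l \<noteq> k" for l
        using less.IH[of l] falling_factorial_of_nat_eq_0[of k l] that
        by (cases "l < k") auto
      then have "(\<Sum>l\<in>{..n} - {k}. (c l - d l) * falling_factorial (real k) l) = 0"
        by (intro sum.neutral) blast
      with eq[of "real k"] True have "(c k - d k) * falling_factorial (real k) k = 0"
        by (subst (asm) sum.remove[of _ k]) auto
      then show ?thesis by (simp add: falling_factorial_of_nat_self)
    next
      case False
      then show ?thesis using c d by simp
    qed
  qed
  then show "c = d" by blast
qed

lemma S2_degenerate_expansion: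
  "degenerate_falling_factorial lam x n = (\<Sum>l\<le>n. S2_degenerate lam n l * falling_factorial x l)"
  using theI'[OF S2_degenerate_ex1[of lam n]] unfolding S2_degenerate_def[symmetric] by blast

end

theory Submission
  imports Defs
begin

text \<open>
  By independence the expectation of \<open>z ^ Z\<close> is the product of the factors
  \<open>(\<alpha> * z + lam * j) / (\<alpha> + lam * j)\<close>, a polynomial in \<open>z\<close>, and the integral extracts its
  coefficient of \<open>z ^ l\<close> by orthogonality of the characters of the circle. Inserting the second
  Stirling expansion into the first shows that the sum over \<open>m\<close> is the coefficient of
  \<open>x ^ (l + 1)\<close> in \<open>x * (x - lam) * \<dots> * (x - n * lam)\<close>, and the substitution
  \<open>x = - \<alpha> * z\<close> turns the latter into the numerator of the former.
\<close>

lemma S1_eq_0: "n < l \<Longrightarrow> S1 n l = 0"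
  by (simp add: S1_eq_stirling)

text \<open>Two changes of basis are composed: degenerate falling factorials to falling factorials,
  then falling factorials to powers.\<close>

lemma degenerate_falling_factorial_power_expansion:
  "degenerate_falling_factorial lam x n =
     (\<Sum>l\<le>n. (\<Sum>m\<le>n. S2_degenerate lam n m * S1 m l) * x ^ l)"
proof -
  \<comment> \<open>Padding with the zeros \<open>S1 m l\<close> for \<open>l > m\<close> makes the
    range of \<open>l\<close> independent of \<open>m\<close>, so the two sums can be
    swapped.\<close>
  have "falling_factorial x m = (\<Sum>l\<le>n. S1 m l * x ^ l)" if "m \<le> n" for m
    unfolding S1_expansion using that by (intro sum.mono_neutral_left) (auto simp: S1_eq_0)
  then have "degenerate_falling_factorial lam x n =
      (\<Sum>m\<le>n. \<Sum>l\<le>n. S2_degenerate lam n m * (S1 m l * x ^ l))"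
    by (simp add: S2_degenerate_expansion sum_distrib_left)
  also have "\<dots> = (\<Sum>l\<le>n. \<Sum>m\<le>n. S2_degenerate lam n m * (S1 m l * x ^ l))"
    by (rule sum.swap)
  finally show ?thesis
    by (simp add: sum_distrib_right mult.assoc)
qed

text \<open>The product is the degenerate falling factorial of length \<open>n + 1\<close> with its
  first factor \<open>x\<close> cancelled; this cancellation shifts both Stirling indices by
  one.\<close>

lemma prod_diff_multiples_expansion:
  fixes x :: real
  assumes "x \<noteq> 0"
  shows "(\<Prod>j=1..n. x - real j * lam) =
    (\<Sum>l\<le>n. (\<Sum>m=l..n. S2_degenerate lam (n + 1) (m + 1) * S1 (m + 1) (l + 1)) * x ^ l)"
proof -
  let ?e = "\<lambda>l. \<Sum>m\<le>Suc n. S2_degenerate lam (Suc n) m * S1 m l"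
  \<comment> \<open>Evaluation at 0, where the factor with index 0 vanishes, isolates the constant
    coefficient.\<close>
  have e0: "?e 0 = 0"
    using degenerate_falling_factorial_power_expansion[of lam 0 "Suc n"]
    by (simp add: degenerate_falling_factorial_def prod.lessThan_Suc_shift sum.atMost_Suc_shift
        del: sum.atMost_Suc prod.lessThan_Suc)
  have eS: "?e (Suc l) =
      (\<Sum>m=l..n. S2_degenerate lam (n + 1) (m + 1) * S1 (m + 1) (l + 1))" for l
  proof -
    \<comment> \<open>The term \<open>m = 0\<close> drops out because
      \<open>S1 0 (Suc l) = 0\<close>; the terms below \<open>l\<close> vanish likewise in the next
      step.\<close>
    have "?e (Suc l) = (\<Sum>m\<le>n. S2_degenerate lam (Suc n) (Suc m) * S1 (Suc m) (Suc l))"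
      by (simp add: sum.atMost_Suc_shift S1_eq_0 del: sum.atMost_Suc)
    also have "\<dots> = (\<Sum>m=l..n. S2_degenerate lam (Suc n) (Suc m) * S1 (Suc m) (Suc l))"
      by (intro sum.mono_neutral_right) (auto simp: S1_eq_0)
    finally show ?thesis by simp
  qed
  have "x * (\<Prod>j=1..n. x - real j * lam) = degenerate_falling_factorial lam x (Suc n)"
    unfolding degenerate_falling_factorial_def
    by (simp add: prod.lessThan_Suc_shift prod.atLeast1_atMost_eq del: prod.lessThan_Suc)
  also have "\<dots> = (\<Sum>l\<le>Suc n. ?e l * x ^ l)"
    by (rule degenerate_falling_factorial_power_expansion)
  also have "\<dots> = x * (\<Sum>l\<le>n. ?e (Suc l) * x ^ l)"
    unfolding sum.atMost_Suc_shift[of "\<lambda>l. ?e l * x ^ l"] e0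
    by (simp add: sum_distrib_left mult_ac del: sum.atMost_Suc)
  finally show ?thesis
    using assms eS by simp
qed

text \<open>A nonzero difference would have finitely many roots, but every positive real is
  one.\<close>

lemma poly_eqI_positive_reals:
  fixes p q :: "complex poly"
  assumes "\<And>x::real. x > 0 \<Longrightarrow> poly p (of_real x) = poly q (of_real x)"
  shows "p = q"
proof (rule ccontr)
  assume "p \<noteq> q"
  then have "finite {z. poly (p - q) z = 0}"
    by (intro poly_roots_finite) simp
  moreover have "complex_of_real ` {0<..} \<subseteq> {z. poly (p - q) z = 0}"
    using assms by auto
  ultimately have "finite (complex_of_real ` {0<..})"
    by (rule finite_subset[rotated])
  then show False
    by (simp add: finite_image_iff inj_on_def infinite_Ioi)
qed

text \<open>Carries a real identity over to complex arguments, where it is needed at points of the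
  unit circle.\<close>

lemma prod_linear_expansion_complex:
  fixes a b c :: "nat \<Rightarrow> real" and z :: complex
  assumes "\<And>x. x > 0 \<Longrightarrow> (\<Prod>j\<in>A. a j * x + b j) = (\<Sum>k\<le>n. c k * x ^ k)"
  shows "(\<Prod>j\<in>A. of_real (a j) * z + of_real (b j)) = (\<Sum>k\<le>n. of_real (c k) * z ^ k)"
proof -
  let ?p = "\<Prod>j\<in>A. [:of_real (b j), of_real (a j):] :: complex poly"
  let ?q = "\<Sum>k\<le>n. monom (of_real (c k)) k :: complex poly"
  have "?p = ?q"
  proof (rule poly_eqI_positive_reals)
    fix x :: real
    assume "x > 0"
    then have "complex_of_real (\<Prod>j\<in>A. a j * x + b j) = of_real (\<Sum>k\<le>n. c k * x ^ k)"
      by (simp only: assms)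
    then show "poly ?p (of_real x) = poly ?q (of_real x)"
      by (simp add: poly_prod poly_sum poly_monom algebra_simps)
  qed
  then have "poly ?p z = poly ?q z" by simp
  then show ?thesis
    by (simp add: poly_prod poly_sum poly_monom algebra_simps)
qed

text \<open>Taking \<open>d\<close> out of each factor leaves a rising factorial, a quotient of
  Gamma values. Reducing \<open>Gamma (a / d + 1)\<close> to \<open>Gamma (a / d)\<close> costs
  \<open>a / d\<close>, hence the exponent \<open>n + 1\<close> and the \<open>a\<close>
  below.\<close>

lemma prod_of_nat_eq_Gamma:
  fixes a d :: real
  assumes "a > 0" "d > 0"
  shows "(\<Prod>j=1..n. a + d * real j) = d ^ (n + 1) * Gamma (real n + a / d + 1) / (a * Gamma (a / d))"
proof -
  have nonpos: "x \<notin> \<int>\<^sub>\<le>\<^sub>0" if "x > 0" for x :: real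
    using that by (auto elim: nonpos_Ints_cases)
  have "(\<Prod>j=1..n. a + d * real j) = (\<Prod>j=1..n. d * (a / d + real j))"
    using assms by (intro prod.cong) (auto simp: field_simps)
  also have "\<dots> = d ^ n * (\<Prod>j=1..n. a / d + real j)"
    by (simp add: prod.distrib)
  also have "(\<Prod>j=1..n. a / d + real j) = pochhammer (a / d + 1) n"
    by (simp add: pochhammer_prod prod.atLeast1_atMost_eq atLeast0LessThan algebra_simps)
  also have "\<dots> = Gamma (a / d + 1 + real n) / Gamma (a / d + 1)"
    using assms by (intro pochhammer_Gamma nonpos) (simp add: add_pos_pos)
  also have "Gamma (a / d + 1) = a / d * Gamma (a / d)"
    using assms by (intro Gamma_plus1 nonpos) simp
  finally show ?thesis
    using assms by (simp add: field_simps)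
qed

lemma integral_character_circle:
  fixes k :: int
  shows "(LBINT \<theta>:{-pi..pi}. exp (\<i> * of_real (\<theta> * of_int k))) = (if k = 0 then 2 * of_real pi else 0)"
proof (cases "k = 0")
  case True
  then show ?thesis by (simp add: set_lebesgue_integral_def scaleR_conv_of_real)
next
  case False
  let ?F = "\<lambda>\<theta>. exp (\<i> * of_real (\<theta> * of_int k)) / (\<i> * of_int k)"
  have "(LBINT \<theta>:{-pi..pi}. exp (\<i> * of_real (\<theta> * of_int k))) = ?F pi - ?F (- pi)"
    unfolding set_lebesgue_integral_def
  proof (rule integral_FTC_Icc)
    show "- pi \<le> pi" by simp
    show "(?F has_vector_derivative exp (\<i> * of_real (t * of_int k))) (at t within {-pi..pi})" for t
      using False
      by (auto intro!: derivative_eq_intros has_vector_derivative_real_field simp: field_simps)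
    show "continuous_on {-pi..pi} (\<lambda>\<theta>. exp (\<i> * of_real (\<theta> * of_int k)))"
      by (intro continuous_intros)
  qed
  \<comment> \<open>The two exponents differ by \<open>2 * pi * k\<close> times the imaginary unit,
    a period of \<open>exp\<close>.\<close>
  also have "exp (\<i> * of_real (pi * of_int k)) = exp (\<i> * of_real (- pi * of_int k))"
    by (rule exp_eq[THEN iffD2]) (auto intro!: exI[of _ k] simp: algebra_simps)
  finally show ?thesis using False by simp
qed

lemma fourier_coefficient_trig_poly:
  fixes c :: "nat \<Rightarrow> complex"
  assumes "l \<le> n"
  shows "(LBINT \<theta>:{-pi..pi}. exp (- \<i> * of_real (\<theta> * real l)) * (\<Sum>k\<le>n. c k * exp (\<i> * of_real \<theta>) ^ k))
    = 2 * of_real pi * c l"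
proof -
  \<comment> \<open>The frequency is an integer difference, since it is negative for
    \<open>k < l\<close>.\<close>
  have "exp (- \<i> * of_real (\<theta> * real l)) * (\<Sum>k\<le>n. c k * exp (\<i> * of_real \<theta>) ^ k) =
      (\<Sum>k\<le>n. c k * exp (\<i> * of_real (\<theta> * of_int (int k - int l))))" for \<theta>
    by (simp add: sum_distrib_left algebra_simps flip: exp_of_nat_mult exp_add)
  then have "(LBINT \<theta>:{-pi..pi}.
        exp (- \<i> * of_real (\<theta> * real l)) * (\<Sum>k\<le>n. c k * exp (\<i> * of_real \<theta>) ^ k)) =
      (LBINT \<theta>:{-pi..pi}. (\<Sum>k\<le>n. c k * exp (\<i> * of_real (\<theta> * of_int (int k - int l)))))"
    by simp
  also have "\<dots> = (\<Sum>k\<le>n. LBINT \<theta>:{-pi..pi}. c k * exp (\<i> * of_real (\<theta> * of_int (int k - int l))))"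
    unfolding set_lebesgue_integral_def scaleR_sum_right
    by (intro Bochner_Integration.integral_sum
        borel_integrable_atLeastAtMost'[unfolded set_integrable_def] continuous_intros)
  also have "\<dots> = (\<Sum>k\<le>n. if k = l then 2 * of_real pi * c k else 0)"
    by (intro sum.cong) (simp_all only: set_integral_mult_right integral_character_circle, simp)
  also have "\<dots> = 2 * of_real pi * c l"
    using assms by simp
  finally show ?thesis .
qed

text \<open>The two masses add up to 1, so \<open>X\<close> is almost surely 0 or 1 and the
  exponential agrees almost everywhere with a combination of two indicators. Integrability is what
  the product rule for independent variables asks for.\<close>

lemma (in prob_space) expectation_exp_Bernoulli:
  fixes X :: "'a \<Rightarrow> real" and t :: complex
  assumes [measurable]: "random_variable borel X"
    and p1: "prob {\<omega> \<in> space M. X \<omega> = 1} = p" and p0: "prob {\<omega> \<in> space M. X \<omega> = 0} = 1 - p"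
  shows "integrable M (\<lambda>\<omega>. exp (t * of_real (X \<omega>)))"
    and "expectation (\<lambda>\<omega>. exp (t * of_real (X \<omega>))) = of_real p * exp t + of_real (1 - p)"
proof -
  let ?A = "{\<omega> \<in> space M. X \<omega> = 1}" and ?B = "{\<omega> \<in> space M. X \<omega> = 0}"
  let ?g = "\<lambda>\<omega>. of_real (indicat_real ?A \<omega>) * exp t + of_real (indicat_real ?B \<omega>)"
  have [measurable]: "?A \<in> events" "?B \<in> events" by measurable
  have "prob (?A \<union> ?B) = 1"
    using p1 p0 by (subst finite_measure_Union) auto
  then have "AE \<omega> in M. \<omega> \<in> ?A \<union> ?B"
    by (subst (asm) prob_eq_1) auto
  then have AE: "AE \<omega> in M. exp (t * of_real (X \<omega>)) = ?g \<omega>"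
    by (rule AE_mp) (auto intro!: AE_I2 simp: indicator_def)
  have iA: "integrable M (\<lambda>\<omega>. of_real (indicat_real ?A \<omega>) * exp t :: complex)"
    and iB: "integrable M (\<lambda>\<omega>. of_real (indicat_real ?B \<omega>) :: complex)"
    by (auto intro!: integrable_mult_left integrable_of_real integrable_real_indicator simp: less_top[symmetric])
  then have ig: "integrable M ?g"
    by (rule Bochner_Integration.integrable_add)
  have meas: "(\<lambda>\<omega>. exp (t * of_real (X \<omega>))) \<in> borel_measurable M"
    by measurable
  from integrable_cong_AE[OF meas borel_measurable_integrable[OF ig] AE] ig
  show "integrable M (\<lambda>\<omega>. exp (t * of_real (X \<omega>)))"
    by (rule iffD2)
  have "expectation (\<lambda>\<omega>. exp (t * of_real (X \<omega>))) = expectation ?g"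
    by (rule integral_cong_AE[OF meas borel_measurable_integrable[OF ig] AE])
  also have "\<dots> = of_real (prob ?A) * exp t + of_real (prob ?B)"
    unfolding Bochner_Integration.integral_add[OF iA iB] by simp
  also have "\<dots> = of_real p * exp t + of_real (1 - p)"
    unfolding p0 p1 by (rule refl)
  finally show "expectation (\<lambda>\<omega>. exp (t * of_real (X \<omega>))) = of_real p * exp t + of_real (1 - p)" .
qed

text \<open>The exponential turns the sum into a product of independent variables, whose expectation
  factors.\<close>

lemma (in prob_space) expectation_exp_sum_Bernoulli:
  fixes X :: "'b \<Rightarrow> 'a \<Rightarrow> real" and t :: complex
  assumes "finite I" and indep: "indep_vars (\<lambda>_. borel) X I"
    and "\<And>j. j \<in> I \<Longrightarrow> prob {\<omega> \<in> space M. X j \<omega> = 1} = p j"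
    and "\<And>j. j \<in> I \<Longrightarrow> prob {\<omega> \<in> space M. X j \<omega> = 0} = 1 - p j"
  shows "expectation (\<lambda>\<omega>. exp (t * of_real (\<Sum>j\<in>I. X j \<omega>))) =
    (\<Prod>j\<in>I. of_real (p j) * exp t + of_real (1 - p j))"
proof -
  have rv: "random_variable borel (X j)" if "j \<in> I" for j
    using indep that by (auto simp: indep_vars_def)
  have "indep_vars (\<lambda>_. borel) (\<lambda>j \<omega>. exp (t * complex_of_real (X j \<omega>))) I"
    by (rule indep_vars_compose2[OF indep, of "\<lambda>_ x. exp (t * of_real x)"]) measurable
  then have "expectation (\<lambda>\<omega>. \<Prod>j\<in>I. exp (t * of_real (X j \<omega>))) =
      (\<Prod>j\<in>I. expectation (\<lambda>\<omega>. exp (t * of_real (X j \<omega>))))"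
    using assms by (intro indep_vars_lebesgue_integral expectation_exp_Bernoulli(1)[OF rv]) auto
  also have "\<dots> = (\<Prod>j\<in>I. of_real (p j) * exp t + of_real (1 - p j))"
    using assms by (intro prod.cong expectation_exp_Bernoulli(2)[OF rv]) auto
  finally show ?thesis
    using \<open>finite I\<close> by (simp add: sum_distrib_left exp_sum)
qed

theorem theorem4:
  fixes M :: "'a measure" and X :: "nat \<Rightarrow> 'a \<Rightarrow> real" and Z :: "'a \<Rightarrow> real"
    and n l :: nat and \<alpha> lam :: real
  assumes "prob_space M"
    and "\<alpha> > 0" and "0 < lam" and "lam < 1"
    and "prob_space.indep_vars M (\<lambda>_. borel) X {1..n}"
    and "\<And>j. j \<in> {1..n} \<Longrightarrow>
           measure M {\<omega> \<in> space M. X j \<omega> = 1} = \<alpha> / (\<alpha> + lam * real j)"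
    and "\<And>j. j \<in> {1..n} \<Longrightarrow>
           measure M {\<omega> \<in> space M. X j \<omega> = 0} = 1 - \<alpha> / (\<alpha> + lam * real j)"
    and "\<And>\<omega>. Z \<omega> = (\<Sum>j=1..n. X j \<omega>)"
    and "l \<le> n"
  shows "complex_of_real (1 / (2 * pi)) *
           (LBINT \<theta>:{-pi..pi}. (LINT \<omega>|M. exp (\<i> * complex_of_real (\<theta> * (Z \<omega> - real l))))) =
         complex_of_real ((-1) ^ (n - l) * (\<alpha> ^ (l + 1) / lam ^ (n + 1)) *
           (Gamma (\<alpha> / lam) / Gamma (real n + \<alpha> / lam + 1)) *
           (\<Sum>m=l..n. S2_degenerate lam (n + 1) (m + 1) * S1 (m + 1) (l + 1)))"
proof -
  interpret prob_space M by fact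
  let ?T = "\<lambda>k. \<Sum>m=k..n. S2_degenerate lam (n + 1) (m + 1) * S1 (m + 1) (k + 1)"
  \<comment> \<open>\<open>?c k / ?D\<close> will be the coefficient of \<open>z ^ k\<close> in the
    generating function of \<open>Z\<close>: the sign \<open>(-1) ^ n\<close> comes from negating
    all \<open>n\<close> factors, the power of \<open>- \<alpha>\<close> from the
    substitution.\<close>
  let ?c = "\<lambda>k. (-1) ^ n * (- \<alpha>) ^ k * ?T k"
  let ?D = "\<Prod>j=1..n. \<alpha> + lam * real j"
  have pos: "\<alpha> + lam * real j > 0" for j
    using assms(2,3) by (simp add: add_pos_nonneg)
  have num: "(\<Prod>j=1..n. of_real \<alpha> * z + of_real (lam * real j)) = (\<Sum>k\<le>n. of_real (?c k) * z ^ k)"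
    for z :: complex
  proof (rule prod_linear_expansion_complex)
    fix x :: real
    assume "x > 0"
    have "(\<Prod>j=1..n. \<alpha> * x + lam * real j) = (\<Prod>j=1..n. (-1) * ((- \<alpha> * x) - real j * lam))"
      by (intro prod.cong) (auto simp: algebra_simps)
    also have "\<dots> = (-1) ^ n * (\<Prod>j=1..n. (- \<alpha> * x) - real j * lam)"
      by (simp only: prod.distrib prod_constant card_atLeastAtMost) simp
    also have "(\<Prod>j=1..n. (- \<alpha> * x) - real j * lam) = (\<Sum>k\<le>n. ?T k * (- \<alpha> * x) ^ k)"
      using \<open>x > 0\<close> assms(2) by (intro prod_diff_multiples_expansion) auto
    finally show "(\<Prod>j=1..n. \<alpha> * x + lam * real j) = (\<Sum>k\<le>n. ?c k * x ^ k)"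
      by (simp only: sum_distrib_left power_mult_distrib mult_ac)
  qed
  \<comment> \<open>The shift by \<open>l\<close> leaves the expectation as a constant phase; the
    rest is a trigonometric polynomial.\<close>
  have char: "(LINT \<omega>|M. exp (\<i> * of_real (\<theta> * (Z \<omega> - real l)))) =
      exp (- \<i> * of_real (\<theta> * real l)) * (\<Sum>k\<le>n. of_real (?c k / ?D) * exp (\<i> * of_real \<theta>) ^ k)"
    for \<theta>
  proof -
    let ?p = "\<lambda>j. \<alpha> / (\<alpha> + lam * real j)"
    have "(LINT \<omega>|M. exp (\<i> * of_real (\<theta> * (Z \<omega> - real l)))) =
        (LINT \<omega>|M. exp (- \<i> * of_real (\<theta> * real l)) *
          exp (\<i> * of_real \<theta> * of_real (\<Sum>j=1..n. X j \<omega>)))"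
      unfolding assms(8) exp_add[symmetric] by (simp add: algebra_simps)
    also have "\<dots> = exp (- \<i> * of_real (\<theta> * real l)) *
        (\<Prod>j=1..n. of_real (?p j) * exp (\<i> * of_real \<theta>) + of_real (1 - ?p j))"
      using expectation_exp_sum_Bernoulli[OF _ assms(5-7), of "\<i> * of_real \<theta>"]
      by simp
    also have "(\<Prod>j=1..n. of_real (?p j) * exp (\<i> * of_real \<theta>) + of_real (1 - ?p j)) =
        (\<Prod>j=1..n. (of_real \<alpha> * exp (\<i> * of_real \<theta>) + of_real (lam * real j)) /
          of_real (\<alpha> + lam * real j))"
    proof (intro prod.cong refl)
      fix j
      have "1 - ?p j = lam * real j / (\<alpha> + lam * real j)"
        using pos[of j] by (simp add: field_simps)
      then show "of_real (?p j) * exp (\<i> * of_real \<theta>) + of_real (1 - ?p j) =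
          (of_real \<alpha> * exp (\<i> * of_real \<theta>) + of_real (lam * real j)) /
            of_real (\<alpha> + lam * real j)"
        by (simp only: of_real_divide add_divide_distrib times_divide_eq_left)
    qed
    also have "\<dots> = (\<Sum>k\<le>n. of_real (?c k) * exp (\<i> * of_real \<theta>) ^ k) / of_real ?D"
      by (simp only: prod_dividef num of_real_prod)
    also have "\<dots> = (\<Sum>k\<le>n. of_real (?c k / ?D) * exp (\<i> * of_real \<theta>) ^ k)"
      by (simp only: sum_divide_distrib of_real_divide times_divide_eq_left)
    finally show ?thesis .
  qed
  have "complex_of_real (1 / (2 * pi)) *
      (LBINT \<theta>:{-pi..pi}. (LINT \<omega>|M. exp (\<i> * of_real (\<theta> * (Z \<omega> - real l))))) =
      of_real (?c l / ?D)"
    unfolding char fourier_coefficient_trig_poly[OF assms(9)] by simp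
  also have "?c l = (-1) ^ (n - l) * \<alpha> ^ l * ?T l"
  proof -
    \<comment> \<open>The numbers \<open>n + l\<close> and \<open>n - l\<close> have the same
      parity.\<close>
    have "(-1) ^ n * (- \<alpha>) ^ l = (-1) ^ (n - l) * \<alpha> ^ l"
      using assms(9) by (simp add: power_minus[of \<alpha>] uminus_power_if)
    then show ?thesis by simp
  qed
  \<comment> \<open>Dividing by \<open>?D\<close> supplies the additional factor \<alpha>, the power
    of \<open>lam\<close> and the Gamma quotient.\<close>
  also have "(-1) ^ (n - l) * \<alpha> ^ l * ?T l / ?D = (-1) ^ (n - l) * (\<alpha> ^ (l + 1) / lam ^ (n + 1)) *
      (Gamma (\<alpha> / lam) / Gamma (real n + \<alpha> / lam + 1)) * ?T l"
    unfolding prod_of_nat_eq_Gamma[OF assms(2,3)] by simp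
  finally show ?thesis .
qed

end
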